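(* Let $(\mathcal{B},\nu)$ be an effective topology with a recursively enumerable subset relation, and let $\phi$ be an oracle for a point $x$ in $(\mathcal{B},\nu)$. Then there exists a nested oracle $\psi$ for $x$ in $(\mathcal{B},\nu)$ that is recursive relative to $\phi$ uniformly.
   Context: Let $X$ be a set with a topology having a countable basis $\mathcal{B}$. A coding of $\mathcal{B}$ is a (not necessarily injective) assignment $n\mapsto\nu(n)$ of basis elements to non-negative integers, every basis element being coded by at least one integer; $\mathrm{dom}_{\mathcal{B}}\nu$ denotes the set of $n$ with $\nu(n)\in\mathcal{B}$. $(\mathcal{B},\nu)$ is an effective topology iff $\mathcal{B}$ is a countable basis for a $T_0$ topology and $\nu$ is a coding of $\mathcal{B}$. A set $\mathcal{L}_x\subseteq\mathcal{B}$ is a local basis for $x$ iff every member contains $x$ and every $B\in\mathcal{B}$ containing $x$ has a subset in $\mathcal{L}_x$. With $\mathbb{N}$ the non-negative integers, a function $\phi:\mathbb{N}\to\mathrm{dom}_{\mathcal{B}}\nu$ is an oracle for $x$ iff $\{\nu(\phi(n)):n\in\mathbb{N}\}$ is a local basis for $x$; it is nested iff $\nu(\phi(n+1))\subseteq\nu(\phi(n))$ for all $n$. The subset relation is recursively enumerable iff $\{\langle b_1,b_2\rangle: b_1,b_2\in\mathrm{dom}_{\mathcal{B}}\nu,\ \nu(b_1)\subseteq\nu(b_2)\}$ is recursively enumerable (Cantor pairing). "Recursive relative to $\phi$ uniformly" means computed from $\phi$ by an oracle Turing machine not depending on $\phi$. *)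

theory Defs
  imports "HOL-Analysis.Analysis" "HOL-Library.Nat_Bijection"
begin

section \<open>Oracle Turing machines\<close>

text \<open>
  Deterministic multitape machines with two-way infinite tapes. A tape is stored relative to its
  head: \<open>t 0\<close> is the scanned cell, \<open>t 1\<close> the cell to its right, \<open>t (-1)\<close> the cell to its left.
  Symbol 0 is the blank and symbol 1 is the mark used for unary numerals.
\<close>

type_synonym symbol = nat
type_synonym tape = "int \<Rightarrow> symbol"

datatype move = Move_Left | Stay | Move_Right

primrec offset :: "move \<Rightarrow> int" where
  "offset Move_Left = - 1"
| "offset Stay = 0"
| "offset Move_Right = 1"

definition write_move :: "symbol \<times> move \<Rightarrow> tape \<Rightarrow> tape" where
  "write_move a t = (\<lambda>i. (t(0 := fst a)) (i + offset (snd a)))"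

definition blank_tape :: tape where
  "blank_tape = (\<lambda>_. 0)"

definition unary_tape :: "nat \<Rightarrow> tape" where
  "unary_tape n = (\<lambda>i. if 0 \<le> i \<and> i < int n then 1 else 0)"

text \<open>
  The number of consecutive marks starting at the head. It is well defined on every tape that is
  blank almost everywhere, hence on every tape that occurs in a computation.
\<close>

definition block_length :: "tape \<Rightarrow> nat" where
  "block_length t = (LEAST n. t (int n) \<noteq> 1)"

lemma block_length_unary_tape [simp]: "block_length (unary_tape n) = n"
  unfolding block_length_def unary_tape_def
  by (rule Least_equality) (auto split: if_splits)

text \<open>
  The states are the positions in the program. \<open>Step \<delta>\<close> is an ordinary state: \<open>\<delta>\<close> maps the list of
  scanned symbols (one for each tape) to the next state and one action for each tape.
  \<open>Query q\<close> replaces the numeral \<open>m\<close> on the query tape, which is tape 1, by the numeral of the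
  value of the oracle at \<open>m\<close> and proceeds to state \<open>q\<close>. Only the finitely many values of \<open>\<delta>\<close> on
  lists of the right length over the alphabet matter.
\<close>

datatype instr =
    Halt
  | Query nat
  | Step "symbol list \<Rightarrow> nat \<times> (symbol \<times> move) list"

record machine =
  num_tapes :: nat
  num_symbols :: nat
  program :: "instr list"

definition well_formed_instr :: "machine \<Rightarrow> instr \<Rightarrow> bool" where
  "well_formed_instr M c \<longleftrightarrow>
     (case c of
        Halt \<Rightarrow> True
      | Query q \<Rightarrow> q < length (program M)
      | Step \<delta> \<Rightarrow>
          \<forall>ss. length ss = num_tapes M \<and> set ss \<subseteq> {..<num_symbols M} \<longrightarrow>
            fst (\<delta> ss) < length (program M) \<and>
            length (snd (\<delta> ss)) = num_tapes M \<and>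
            fst ` set (snd (\<delta> ss)) \<subseteq> {..<num_symbols M})"

definition oracle_turing_machine :: "machine \<Rightarrow> bool" where
  "oracle_turing_machine M \<longleftrightarrow>
     2 \<le> num_tapes M \<and> 2 \<le> num_symbols M \<and> program M \<noteq> [] \<and>
     (\<forall>c \<in> set (program M). well_formed_instr M c)"

definition turing_machine :: "machine \<Rightarrow> bool" where
  "turing_machine M \<longleftrightarrow> oracle_turing_machine M \<and> (\<forall>q. Query q \<notin> set (program M))"

type_synonym config = "nat \<times> tape list"

definition step :: "machine \<Rightarrow> (nat \<Rightarrow> nat) \<Rightarrow> config \<Rightarrow> config" where
  "step M \<phi> = (\<lambda>(q, ts).
     case program M ! q of
       Halt \<Rightarrow> (q, ts)
     | Query q' \<Rightarrow> (q', ts[1 := unary_tape (\<phi> (block_length (ts ! 1)))])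
     | Step \<delta> \<Rightarrow>
         (let (q', as) = \<delta> (map (\<lambda>t. t 0) ts)
          in (q', map2 write_move as ts)))"

definition numeral_tapes :: "machine \<Rightarrow> nat \<Rightarrow> tape list" where
  "numeral_tapes M n = unary_tape n # replicate (num_tapes M - 1) blank_tape"

text \<open>
  Input and output are on tape 0. Machines halt in standard configuration: all the other tapes are
  blank and the head is at the start of the output.
\<close>

definition computes :: "machine \<Rightarrow> (nat \<Rightarrow> nat) \<Rightarrow> (nat \<Rightarrow> nat) \<Rightarrow> bool" where
  "computes M \<phi> f \<longleftrightarrow>
     (\<forall>n. \<exists>k q. (step M \<phi> ^^ k) (0, numeral_tapes M n) = (q, numeral_tapes M (f n)) \<and>
                program M ! q = Halt)"

definition recursive :: "(nat \<Rightarrow> nat) \<Rightarrow> bool" where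
  "recursive f \<longleftrightarrow> (\<exists>M. turing_machine M \<and> computes M (\<lambda>_. 0) f)"
  \<comment> \<open>the choice of the oracle is irrelevant, as \<open>M\<close> makes no queries\<close>

definition recursively_enumerable :: "nat set \<Rightarrow> bool" where
  "recursively_enumerable A \<longleftrightarrow> A = {} \<or> (\<exists>f. recursive f \<and> A = range f)"


section \<open>Effective topologies\<close>

definition basis_of :: "'a topology \<Rightarrow> 'a set set \<Rightarrow> bool" where
  "basis_of T \<B> \<longleftrightarrow>
     (\<forall>V \<in> \<B>. openin T V) \<and>
     (\<forall>U x. openin T U \<and> x \<in> U \<longrightarrow> (\<exists>V \<in> \<B>. x \<in> V \<and> V \<subseteq> U))"

text \<open>
  A coding is a partial map, so that integers may code nothing. Integers coding sets outside
  \<open>\<B>\<close> are also allowed; they are excluded from \<open>code_dom \<B> \<nu>\<close>.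
\<close>

definition coding :: "'a set set \<Rightarrow> (nat \<rightharpoonup> 'a set) \<Rightarrow> bool" where
  "coding \<B> \<nu> \<longleftrightarrow> (\<forall>B \<in> \<B>. \<exists>n. \<nu> n = Some B)"

definition code_dom :: "'a set set \<Rightarrow> (nat \<rightharpoonup> 'a set) \<Rightarrow> nat set" where
  "code_dom \<B> \<nu> = {n. \<exists>B \<in> \<B>. \<nu> n = Some B}"

definition effective_topology :: "'a topology \<Rightarrow> 'a set set \<Rightarrow> (nat \<rightharpoonup> 'a set) \<Rightarrow> bool" where
  "effective_topology T \<B> \<nu> \<longleftrightarrow>
     t0_space T \<and> countable \<B> \<and> basis_of T \<B> \<and> coding \<B> \<nu>"

definition local_basis :: "'a set set \<Rightarrow> 'a \<Rightarrow> 'a set set \<Rightarrow> bool" where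
  "local_basis \<B> x \<L> \<longleftrightarrow>
     \<L> \<subseteq> \<B> \<and> (\<forall>L \<in> \<L>. x \<in> L) \<and> (\<forall>B \<in> \<B>. x \<in> B \<longrightarrow> (\<exists>L \<in> \<L>. L \<subseteq> B))"

definition oracle_for :: "'a set set \<Rightarrow> (nat \<rightharpoonup> 'a set) \<Rightarrow> 'a \<Rightarrow> (nat \<Rightarrow> nat) \<Rightarrow> bool" where
  "oracle_for \<B> \<nu> x \<phi> \<longleftrightarrow>
     range \<phi> \<subseteq> code_dom \<B> \<nu> \<and> local_basis \<B> x {the (\<nu> (\<phi> n)) | n. True}"

definition nested :: "(nat \<rightharpoonup> 'a set) \<Rightarrow> (nat \<Rightarrow> nat) \<Rightarrow> bool" where
  "nested \<nu> \<phi> \<longleftrightarrow> (\<forall>n. the (\<nu> (\<phi> (Suc n))) \<subseteq> the (\<nu> (\<phi> n)))"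

definition subset_relation :: "'a set set \<Rightarrow> (nat \<rightharpoonup> 'a set) \<Rightarrow> nat set" where
  "subset_relation \<B> \<nu> =
     {prod_encode (b\<^sub>1, b\<^sub>2) | b\<^sub>1 b\<^sub>2.
        b\<^sub>1 \<in> code_dom \<B> \<nu> \<and> b\<^sub>2 \<in> code_dom \<B> \<nu> \<and> the (\<nu> b\<^sub>1) \<subseteq> the (\<nu> b\<^sub>2)}"

end

theory Submission
  imports Defs
begin

text \<open>
  Put \<open>\<psi> 0 = \<phi> 0\<close>, and let \<open>\<psi> (n + 1)\<close> be the first \<open>\<phi> k\<close> found by a search through all
  \<open>(k, i\<^sub>1, i\<^sub>2)\<close> such that an enumeration \<open>f\<close> of the subset relation yields the pair
  \<open>(\<phi> k, \<psi> n)\<close> at \<open>i\<^sub>1\<close> and \<open>(\<phi> k, \<phi> (n + 1))\<close> at \<open>i\<^sub>2\<close>. The search succeeds because \<open>\<nu> (\<psi> n)\<close>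
  and \<open>\<nu> (\<phi> (n + 1))\<close> are neighbourhoods of \<open>x\<close>, so a basis element around \<open>x\<close> lies in both, and some
  \<open>\<nu> (\<phi> k)\<close> lies in that one. To obtain a machine, the search is written as a program over unary
  registers, one per tape, whose subroutine call embeds a machine for \<open>f\<close> on separate tapes.
\<close>

section \<open>Register programs\<close>

datatype com =
    Inc nat
  | Dec nat
  | Ask
  | Call
  | Seq com com  (infixr ";;" 60)
  | Cond nat com com
  | While nat com

text \<open>\<open>Ask\<close> works on register 1, because tape 1 is the query tape. \<open>Call\<close> works on register \<open>F\<close>,
  the last one: it is stored on the first tape of the subroutine machine.\<close>

inductive exec :: "(nat \<Rightarrow> nat) \<Rightarrow> (nat \<Rightarrow> nat) \<Rightarrow> nat \<Rightarrow> com \<Rightarrow> (nat \<Rightarrow> nat) \<Rightarrow> (nat \<Rightarrow> nat) \<Rightarrow> bool"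
  for \<phi> f :: "nat \<Rightarrow> nat" and F :: nat where
  Inc: "exec \<phi> f F (Inc r) s (s(r := Suc (s r)))"
| Dec: "exec \<phi> f F (Dec r) s (s(r := s r - 1))"
| Ask: "exec \<phi> f F Ask s (s(1 := \<phi> (s 1)))"
| Call: "exec \<phi> f F Call s (s(F := f (s F)))"
| Seq: "exec \<phi> f F c s s' \<Longrightarrow> exec \<phi> f F d s' s'' \<Longrightarrow> exec \<phi> f F (c ;; d) s s''"
| CondTrue: "s r \<noteq> 0 \<Longrightarrow> exec \<phi> f F c s s' \<Longrightarrow> exec \<phi> f F (Cond r c d) s s'"
| CondFalse: "s r = 0 \<Longrightarrow> exec \<phi> f F d s s' \<Longrightarrow> exec \<phi> f F (Cond r c d) s s'"
| WhileTrue: "s r \<noteq> 0 \<Longrightarrow> exec \<phi> f F c s s' \<Longrightarrow> exec \<phi> f F (While r c) s' s'' \<Longrightarrow>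
    exec \<phi> f F (While r c) s s''"
| WhileFalse: "s r = 0 \<Longrightarrow> exec \<phi> f F (While r c) s s"

inductive_cases exec_IncE: "exec \<phi> f F (Inc r) s s'"
inductive_cases exec_DecE: "exec \<phi> f F (Dec r) s s'"
inductive_cases exec_AskE: "exec \<phi> f F Ask s s'"
inductive_cases exec_CallE: "exec \<phi> f F Call s s'"
inductive_cases exec_SeqE: "exec \<phi> f F (c ;; d) s s'"
inductive_cases exec_CondE: "exec \<phi> f F (Cond r c d) s s'"
inductive_cases exec_WhileE: "exec \<phi> f F (While r c) s s'"

primrec registers :: "com \<Rightarrow> nat set" where
  "registers (Inc r) = {r}"
| "registers (Dec r) = {r}"
| "registers Ask = {}"
| "registers Call = {}"
| "registers (c ;; d) = registers c \<union> registers d"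
| "registers (Cond r c d) = insert r (registers c \<union> registers d)"
| "registers (While r c) = insert r (registers c)"


section \<open>Compilation to Turing machines\<close>

definition stay :: "symbol list \<Rightarrow> (symbol \<times> move) list" where
  "stay ss = map (\<lambda>x. (x, Stay)) ss"

definition tape_step :: "nat \<Rightarrow> (symbol \<Rightarrow> nat \<times> symbol \<times> move) \<Rightarrow> instr" where
  "tape_step r d = Step (\<lambda>ss. (fst (d (ss ! r)), (stay ss)[r := snd (d (ss ! r))]))"

definition goto :: "nat \<Rightarrow> instr" where
  "goto q = tape_step 0 (\<lambda>x. (q, x, Stay))"

text \<open>A unary numeral is zero iff the cell under its head is blank, so one scanned symbol
  decides.\<close>

definition test :: "nat \<Rightarrow> nat \<Rightarrow> nat \<Rightarrow> instr" where
  "test r q q' = tape_step r (\<lambda>x. (if x = 0 then q' else q, x, Stay))"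

text \<open>The subroutine owns the tapes from \<open>F\<close> on, and its states are shifted by
  \<open>b\<close>. It makes no queries, so it leaves only through \<open>Halt\<close>, which
  becomes a jump to the exit \<open>e\<close>.\<close>

definition lift_instr :: "nat \<Rightarrow> nat \<Rightarrow> nat \<Rightarrow> instr \<Rightarrow> instr" where
  "lift_instr F b e c =
     (case c of
        Step \<delta> \<Rightarrow> Step (\<lambda>ss. (b + fst (\<delta> (drop F ss)), stay (take F ss) @ snd (\<delta> (drop F ss))))
      | _ \<Rightarrow> goto e)"

text \<open>Numerals grow and shrink at their left end, under the head, so \<open>Inc\<close> and
  \<open>Dec\<close> never search for the end of a block. The start address \<open>b\<close> is a
  parameter because jump targets are absolute.\<close>

primrec compile :: "machine \<Rightarrow> nat \<Rightarrow> com \<Rightarrow> nat \<Rightarrow> instr list" where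
  "compile N F (Inc r) b =
     [tape_step r (\<lambda>x. (b + 1, x, Move_Left)), tape_step r (\<lambda>x. (b + 2, 1, Stay))]"
| "compile N F (Dec r) b =
     [tape_step r (\<lambda>x. (b + 1, if x = 0 then (0, Stay) else (0, Move_Right)))]"
| "compile N F Ask b = [Query (b + 1)]"
| "compile N F Call b = map (lift_instr F b (b + length (program N))) (program N)"
| "compile N F (c ;; d) b =
     (let p = compile N F c b in p @ compile N F d (b + length p))"
| "compile N F (Cond r c d) b =
     (let p = compile N F c (b + 1);
          e = b + length p + 2;
          p' = compile N F d e
      in test r (b + 1) e # p @ goto (e + length p') # p')"
| "compile N F (While r c) b =
     (let p = compile N F c (b + 1)
      in test r (b + 1) (b + length p + 2) # p @ [goto b])"

definition machine_of :: "machine \<Rightarrow> nat \<Rightarrow> com \<Rightarrow> machine" where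
  "machine_of N F c =
     \<lparr>num_tapes = F + num_tapes N, num_symbols = num_symbols N, program = compile N F c 0 @ [Halt]\<rparr>"

definition tapes :: "machine \<Rightarrow> nat \<Rightarrow> (nat \<Rightarrow> nat) \<Rightarrow> tape list" where
  "tapes N F s = map (\<lambda>i. unary_tape (s i)) [0..<F] @ numeral_tapes N (s F)"

definition code_at :: "instr list \<Rightarrow> nat \<Rightarrow> instr list \<Rightarrow> bool" where
  "code_at P b p \<longleftrightarrow> (\<forall>i < length p. P ! (b + i) = p ! i)"

lemma code_at_Nil [simp]: "code_at P b []"
  by (simp add: code_at_def)

lemma code_at_Cons [simp]: "code_at P b (c # p) \<longleftrightarrow> P ! b = c \<and> code_at P (Suc b) p"
  by (auto simp: code_at_def less_Suc_eq_0_disj)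

lemma code_at_append [simp]:
  "code_at P b (p @ p') \<longleftrightarrow> code_at P b p \<and> code_at P (b + length p) p'"
  by (induction p arbitrary: b) auto

definition reaches :: "machine \<Rightarrow> (nat \<Rightarrow> nat) \<Rightarrow> config \<Rightarrow> config \<Rightarrow> bool" where
  "reaches M \<phi> C C' \<longleftrightarrow> (\<exists>k. (step M \<phi> ^^ k) C = C')"

lemma reaches_refl [simp]: "reaches M \<phi> C C"
  unfolding reaches_def by (rule exI[of _ 0]) simp

lemma reaches_trans [trans]: "reaches M \<phi> C C' \<Longrightarrow> reaches M \<phi> C' C'' \<Longrightarrow> reaches M \<phi> C C''"
  unfolding reaches_def by (metis comp_apply funpow_add)

lemma reaches_step: "step M \<phi> C = C' \<Longrightarrow> reaches M \<phi> C C'"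
  unfolding reaches_def by (rule exI[of _ 1]) simp

section \<open>Effect of single instructions on unary tapes\<close>

lemma write_move_Stay [simp]: "write_move (t 0, Stay) t = t"
  by (simp add: write_move_def)

text \<open>The cell to the left of a numeral is blank; the mark written there becomes its new first
  mark.\<close>

lemma write_move_unary_Inc:
  "write_move (Suc 0, Stay) (write_move (unary_tape n 0, Move_Left) (unary_tape n)) = unary_tape (Suc n)"
  by (auto simp: write_move_def unary_tape_def fun_eq_iff)

lemma write_move_unary_Dec:
  "write_move (if unary_tape n 0 = 0 then (0, Stay) else (0, Move_Right)) (unary_tape n) = unary_tape (n - 1)"
  by (auto simp: write_move_def unary_tape_def fun_eq_iff)

lemma unary_tape_0_eq_0 [simp]: "unary_tape n 0 = 0 \<longleftrightarrow> n = 0"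
  by (simp add: unary_tape_def)

lemma length_stay [simp]: "length (stay ss) = length ss"
  by (simp add: stay_def)

lemma map2_write_move_stay [simp]: "map2 write_move (stay (map (\<lambda>t. t 0) ts)) ts = ts"
  by (rule nth_equalityI) (auto simp: stay_def)

lemma step_tape_step:
  assumes "program M ! q = tape_step r d" "r < length ts"
  shows "step M \<phi> (q, ts) =
    (fst (d ((ts ! r) 0)), ts[r := write_move (snd (d ((ts ! r) 0))) (ts ! r)])"
proof -
  have "map2 write_move ((stay (map (\<lambda>t. t 0) ts))[r := a]) ts = ts[r := write_move a (ts ! r)]" for a
    using assms(2) by (intro nth_equalityI) (simp_all add: stay_def nth_list_update)
  then show ?thesis
    using assms by (simp add: step_def tape_step_def)
qed

lemma step_goto: "program M ! q = goto q' \<Longrightarrow> ts \<noteq> [] \<Longrightarrow> step M \<phi> (q, ts) = (q', ts)"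
  by (simp add: goto_def step_tape_step)

lemma step_test:
  "program M ! q = test r q' q'' \<Longrightarrow> r < length ts \<Longrightarrow>
    step M \<phi> (q, ts) = (if (ts ! r) 0 = 0 then q'' else q', ts)"
  by (simp add: test_def step_tape_step)

text \<open>Well-formedness constrains a transition function only on lists of the right length over
  the alphabet. This invariant keeps a run inside that region and inside the program.\<close>

definition legal_config :: "machine \<Rightarrow> config \<Rightarrow> bool" where
  "legal_config M C \<longleftrightarrow> fst C < length (program M) \<and> length (snd C) = num_tapes M \<and>
     (\<forall>t \<in> set (snd C). range t \<subseteq> {..<num_symbols M})"

lemma legal_config_step:
  assumes "turing_machine M" "legal_config M C"
  shows "legal_config M (step M \<phi> C)"
proof (cases C)
  case (Pair q ts)
  with assms have q: "q < length (program M)" and len: "length ts = num_tapes M"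
    and sym: "\<And>t i. t \<in> set ts \<Longrightarrow> t i < num_symbols M"
    by (auto simp: legal_config_def)
  from q have mem: "program M ! q \<in> set (program M)" by simp
  show ?thesis
  proof (cases "program M ! q")
    case Halt
    with assms Pair show ?thesis by (simp add: step_def)
  next
    case (Query q')
    with mem assms show ?thesis by (simp add: turing_machine_def)
  next
    case (Step \<delta>)
    define as where "as = snd (\<delta> (map (\<lambda>t. t 0) ts))"
    have "well_formed_instr M (Step \<delta>)"
      using mem assms Step by (auto simp: turing_machine_def oracle_turing_machine_def)
    moreover have "set (map (\<lambda>t. t 0) ts) \<subseteq> {..<num_symbols M}"
      using sym by auto
    ultimately have q': "fst (\<delta> (map (\<lambda>t. t 0) ts)) < length (program M)"
      and las: "length as = num_tapes M" and sas: "fst ` set as \<subseteq> {..<num_symbols M}"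
      using len by (auto simp: well_formed_instr_def as_def)
    have "write_move a t i < num_symbols M" if "(a, t) \<in> set (zip as ts)" for a t i
      using sym[OF set_zip_rightD[OF that]] set_zip_leftD[OF that] sas
      by (auto simp: write_move_def)
    then show ?thesis
      using q' las len Step Pair
      by (auto simp: legal_config_def step_def as_def split_beta)
  qed
qed

text \<open>The bound on \<open>F\<close> keeps the input/output tape 0 and the query tape 1 apart
  from the tapes of the subroutine.\<close>

locale subroutine =
  fixes N :: machine and f :: "nat \<Rightarrow> nat" and F :: nat
  assumes N: "turing_machine N" and computes_f: "computes N (\<lambda>_. 0) f" and F: "2 \<le> F"
begin

section \<open>Simulation of register programs by compiled code\<close>

lemma N_bounds: "2 \<le> num_tapes N" "2 \<le> num_symbols N" "program N \<noteq> []"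
  using N by (auto simp: turing_machine_def oracle_turing_machine_def)

lemma length_tapes: "length (tapes N F s) = F + num_tapes N"
  using N_bounds by (simp add: tapes_def numeral_tapes_def)

lemma tapes_nonempty: "tapes N F s \<noteq> []"
  using length_tapes[of s] F by auto

lemma nth_tapes: "r \<le> F \<Longrightarrow> tapes N F s ! r = unary_tape (s r)"
  by (cases "r = F") (simp_all add: tapes_def numeral_tapes_def nth_append)

lemma tapes_update: "r \<le> F \<Longrightarrow> (tapes N F s)[r := unary_tape n] = tapes N F (s(r := n))"
proof (cases "r = F")
  case False
  assume "r \<le> F"
  with False have "(map (\<lambda>i. unary_tape (s i)) [0..<F])[r := unary_tape n] =
      map (\<lambda>i. unary_tape ((s(r := n)) i)) [0..<F]"
    by (intro nth_equalityI) (simp_all add: nth_list_update)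
  then show ?thesis using False \<open>r \<le> F\<close>
    by (simp add: tapes_def list_update_append)
qed (auto simp: tapes_def numeral_tapes_def list_update_append)

text \<open>Since \<open>N\<close> makes no queries, the instruction is a \<open>Step\<close>, so
  the oracle \<phi>' of the embedded run is unrelated to \<phi>. \<open>Halt\<close> is excluded
  because its lifted form leaves the subroutine instead of idling.\<close>

lemma step_lift:
  assumes "code_at (program M) b (compile N F Call b)" and "legal_config N (q, ts)"
    and "length us = F" and "program N ! q \<noteq> Halt" and "step N \<phi>' (q, ts) = (q', ts')"
  shows "step M \<phi> (b + q, us @ ts) = (b + q', us @ ts')"
proof -
  have q: "q < length (program N)" and len: "length ts = num_tapes N"
    using assms(2) by (auto simp: legal_config_def)
  have "program N ! q \<in> set (program N)" using q by simp
  then obtain \<delta> where \<delta>: "program N ! q = Step \<delta>"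
    using assms(4) N unfolding turing_machine_def by (metis instr.exhaust)
  have "program M ! (b + q) = lift_instr F b (b + length (program N)) (Step \<delta>)"
    using assms(1) q \<delta> by (auto simp: code_at_def)
  moreover have "map2 write_move (stay (map (\<lambda>t. t 0) us) @ as) (us @ ts) = us @ map2 write_move as ts" for as
    by (simp add: zip_append)
  ultimately show ?thesis
    using assms(3,5) \<delta> by (simp add: step_def lift_instr_def split_beta)
qed

text \<open>A halted \<open>N\<close> idles while the host takes no step at all, so the host run may
  be shorter than \<open>k\<close>.\<close>

lemma reaches_lift:
  assumes "code_at (program M) b (compile N F Call b)" and "length us = F" and "legal_config N C"
  shows "reaches M \<phi> (b + fst C, us @ snd C)
    (b + fst ((step N \<phi>' ^^ k) C), us @ snd ((step N \<phi>' ^^ k) C))"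
  using assms(3)
proof (induction k arbitrary: C)
  case (Suc k)
  obtain q ts where C: "C = (q, ts)" by (cases C)
  have "reaches M \<phi> (b + fst C, us @ snd C) (b + fst (step N \<phi>' C), us @ snd (step N \<phi>' C))"
  proof (cases "program N ! q = Halt")
    case True
    then show ?thesis by (simp add: C step_def)
  next
    case False
    then show ?thesis
      using step_lift[OF assms(1) _ assms(2) False, of ts \<phi>'] Suc.prems C
      by (intro reaches_step) (metis fst_conv snd_conv surj_pair)
  qed
  also have "reaches M \<phi> \<dots> (b + fst ((step N \<phi>' ^^ k) (step N \<phi>' C)),
      us @ snd ((step N \<phi>' ^^ k) (step N \<phi>' C)))"
    by (rule Suc.IH) (rule legal_config_step[OF N Suc.prems])
  finally show ?case by (simp add: funpow_swap1)
qed simp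

lemma reaches_Call:
  assumes "code_at (program M) b (compile N F Call b)"
  shows "reaches M \<phi> (b, tapes N F s) (b + length (program N), tapes N F (s(F := f (s F))))"
proof -
  define us where "us = map (\<lambda>i. unary_tape (s i)) [0..<F]"
  let ?C = "(0, numeral_tapes N (s F))"
  obtain k q where k: "(step N (\<lambda>_. 0) ^^ k) ?C = (q, numeral_tapes N (f (s F)))"
    and halt: "program N ! q = Halt"
    using computes_f unfolding computes_def by blast
  have legal: "legal_config N ?C"
    using N_bounds by (auto simp: legal_config_def numeral_tapes_def unary_tape_def blank_tape_def)
  \<comment> \<open>Legality puts the halting state inside the program, where \<open>code_at\<close>
    determines the instruction of the host.\<close>
  have "legal_config N ((step N (\<lambda>_. 0) ^^ k) ?C)" for k
    by (induction k) (simp_all add: legal legal_config_step[OF N])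
  from this[of k] have q: "q < length (program N)"
    by (simp add: k legal_config_def)
  have "reaches M \<phi> (b, us @ numeral_tapes N (s F)) (b + q, us @ numeral_tapes N (f (s F)))"
    using reaches_lift[OF assms _ legal, where us = us and \<phi>' = "\<lambda>_. 0" and k = k] by (simp add: k us_def)
  moreover have "program M ! (b + q) = goto (b + length (program N))"
    using assms q halt by (auto simp: code_at_def lift_instr_def)
  then have "step M \<phi> (b + q, us @ numeral_tapes N (f (s F))) =
      (b + length (program N), us @ numeral_tapes N (f (s F)))"
    by (rule step_goto) (simp add: numeral_tapes_def)
  ultimately have "reaches M \<phi> (b, us @ numeral_tapes N (s F))
      (b + length (program N), us @ numeral_tapes N (f (s F)))"
    using reaches_step reaches_trans by metis
  moreover have "tapes N F s = us @ numeral_tapes N (s F)"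
    "tapes N F (s(F := f (s F))) = us @ numeral_tapes N (f (s F))"
    by (simp_all add: tapes_def us_def)
  ultimately show ?thesis by simp
qed

text \<open>Induction on the execution, with \<open>b\<close> arbitrary because subprograms sit at
  later addresses. The bound on the registers gives each of them a tape.\<close>

lemma reaches_compile:
  assumes "exec \<phi> f F c s s'" and "registers c \<subseteq> {..F}" and "code_at (program M) b (compile N F c b)"
  shows "reaches M \<phi> (b, tapes N F s) (b + length (compile N F c b), tapes N F s')"
  using assms
proof (induction arbitrary: b rule: exec.induct)
  case (Inc r s)
  define t where "t = write_move (unary_tape (s r) 0, Move_Left) (unary_tape (s r))"
  have r: "r \<le> F" "r < length (tapes N F s)"
    using Inc N_bounds by (auto simp: length_tapes)
  have "reaches M \<phi> (b, tapes N F s) (b + 1, (tapes N F s)[r := t])"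
    using Inc r by (intro reaches_step) (simp add: step_tape_step nth_tapes t_def)
  moreover have "reaches M \<phi> (b + 1, (tapes N F s)[r := t]) (b + 2, tapes N F (s(r := Suc (s r))))"
    using Inc r
    by (intro reaches_step)
      (simp add: step_tape_step t_def write_move_unary_Inc tapes_update)
  ultimately have "reaches M \<phi> (b, tapes N F s) (b + 2, tapes N F (s(r := Suc (s r))))"
    by (rule reaches_trans)
  then show ?case by (simp add: numeral_2_eq_2 fun_upd_def)
next
  case (Dec r s)
  have r: "r \<le> F" "r < length (tapes N F s)"
    using Dec N_bounds by (auto simp: length_tapes)
  show ?case
    using Dec r write_move_unary_Dec[of "s r"]
    by (intro reaches_step) (simp add: step_tape_step nth_tapes tapes_update fun_upd_def[symmetric])
next
  case (Ask s)
  then show ?case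
    using F by (intro reaches_step) (simp add: step_def nth_tapes tapes_update fun_upd_def[symmetric])
next
  case (Call s)
  then show ?case using reaches_Call[of M b \<phi> s] by (simp add: fun_upd_def)
next
  case (Seq c s s' d s'')
  let ?p = "compile N F c b"
  have "reaches M \<phi> (b, tapes N F s) (b + length ?p, tapes N F s')"
    using Seq.prems by (intro Seq.IH) (auto simp: Let_def)
  also have "reaches M \<phi> \<dots> (b + length ?p + length (compile N F d (b + length ?p)), tapes N F s'')"
    using Seq.prems by (intro Seq.IH) (auto simp: Let_def)
  finally show ?case by (simp add: Let_def add.assoc)
next
  case (CondTrue s r c s' d)
  let ?p = "compile N F c (b + 1)"
  let ?p' = "compile N F d (b + length ?p + 2)"
  have r: "r \<le> F" "r < length (tapes N F s)"
    using CondTrue.prems N_bounds by (auto simp: length_tapes)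
  have "reaches M \<phi> (b, tapes N F s) (b + 1, tapes N F s)"
    using CondTrue r by (intro reaches_step) (simp add: step_test Let_def nth_tapes)
  also have "reaches M \<phi> \<dots> (b + 1 + length ?p, tapes N F s')"
    using CondTrue.prems by (intro CondTrue.IH) (auto simp: Let_def)
  also have "reaches M \<phi> \<dots> (b + length ?p + 2 + length ?p', tapes N F s')"
    using CondTrue.prems tapes_nonempty by (intro reaches_step step_goto) (auto simp: Let_def)
  finally show ?case by (simp add: Let_def add.assoc)
next
  case (CondFalse s r d s' c)
  let ?p = "compile N F c (b + 1)"
  let ?p' = "compile N F d (b + length ?p + 2)"
  have r: "r \<le> F" "r < length (tapes N F s)"
    using CondFalse.prems N_bounds by (auto simp: length_tapes)
  have "reaches M \<phi> (b, tapes N F s) (b + length ?p + 2, tapes N F s)"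
    using CondFalse r by (intro reaches_step) (simp add: step_test Let_def nth_tapes)
  also have "reaches M \<phi> \<dots> (b + length ?p + 2 + length ?p', tapes N F s')"
    using CondFalse.prems by (intro CondFalse.IH) (auto simp: Let_def)
  finally show ?case by (simp add: Let_def add.assoc)
next
  case (WhileTrue s r c s' s'')
  let ?p = "compile N F c (b + 1)"
  have r: "r \<le> F" "r < length (tapes N F s)"
    using WhileTrue.prems N_bounds by (auto simp: length_tapes)
  have "reaches M \<phi> (b, tapes N F s) (b + 1, tapes N F s)"
    using WhileTrue r by (intro reaches_step) (simp add: step_test Let_def nth_tapes)
  also have "reaches M \<phi> \<dots> (b + 1 + length ?p, tapes N F s')"
    using WhileTrue.prems by (intro WhileTrue.IH) (auto simp: Let_def)
  also have "reaches M \<phi> \<dots> (b, tapes N F s')"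
    using WhileTrue.prems tapes_nonempty by (intro reaches_step step_goto) (auto simp: Let_def)
  also have "reaches M \<phi> \<dots> (b + length (compile N F (While r c) b), tapes N F s'')"
    using WhileTrue.prems by (intro WhileTrue.IH)
  finally show ?case .
next
  case (WhileFalse s r c)
  have r: "r \<le> F" "r < length (tapes N F s)"
    using WhileFalse.prems N_bounds by (auto simp: length_tapes)
  show ?case
    using WhileFalse r by (intro reaches_step) (simp add: step_test Let_def nth_tapes)
qed

lemma computes_machine_of:
  assumes "\<And>n. exec \<phi> f F c ((\<lambda>_. 0)(0 := n)) ((\<lambda>_. 0)(0 := \<psi> n))" and "registers c \<subseteq> {..F}"
  shows "computes (machine_of N F c) \<phi> \<psi>"
  unfolding computes_def
proof
  fix n
  let ?M = "machine_of N F c"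
  \<comment> \<open>A zero register is a blank tape, so a state that vanishes off register 0 is a
    standard configuration.\<close>
  have tapes: "tapes N F ((\<lambda>_. 0)(0 := m)) = numeral_tapes ?M m" for m
    using N_bounds F nth_tapes[of _ "(\<lambda>_. 0)(0 := m)"]
    by (intro nth_equalityI)
      (auto simp: length_tapes numeral_tapes_def machine_of_def tapes_def nth_append nth_Cons'
        unary_tape_def blank_tape_def fun_eq_iff)
  have "code_at (program ?M) 0 (compile N F c 0)"
    by (auto simp: code_at_def machine_of_def nth_append)
  from reaches_compile[OF assms(1) assms(2) this]
  have "reaches ?M \<phi> (0, numeral_tapes ?M n) (length (compile N F c 0), numeral_tapes ?M (\<psi> n))"
    by (simp add: tapes)
  moreover have "program ?M ! length (compile N F c 0) = Halt"
    by (simp add: machine_of_def)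
  ultimately show "\<exists>k q. (step ?M \<phi> ^^ k) (0, numeral_tapes ?M n) = (q, numeral_tapes ?M (\<psi> n)) \<and>
      program ?M ! q = Halt"
    unfolding reaches_def by blast
qed

section \<open>Well-formedness of compiled machines\<close>

lemma well_formed_tape_step:
  assumes "2 \<le> num_symbols M"
    and "\<And>x. x < num_symbols M \<Longrightarrow> fst (d x) < length (program M) \<and> fst (snd (d x)) < num_symbols M"
    and "r < num_tapes M"
  shows "well_formed_instr M (tape_step r d)"
  unfolding well_formed_instr_def tape_step_def instr.case
proof (intro allI impI)
  fix ss
  assume ss: "length ss = num_tapes M \<and> set ss \<subseteq> {..<num_symbols M}"
  then have "ss ! r < num_symbols M"
    using assms(3) nth_mem[of r ss] by (metis lessThan_iff subsetD)
  then have d: "fst (d (ss ! r)) < length (program M)" "fst (snd (d (ss ! r))) < num_symbols M"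
    using assms(2) by blast+
  have "set ((stay ss)[r := snd (d (ss ! r))]) \<subseteq> insert (snd (d (ss ! r))) (set (stay ss))"
    by (rule set_update_subset_insert)
  moreover have "fst ` set (stay ss) \<subseteq> {..<num_symbols M}"
    using ss by (auto simp: stay_def)
  ultimately have "fst ` set ((stay ss)[r := snd (d (ss ! r))]) \<subseteq> {..<num_symbols M}"
    using d(2) by (meson image_mono insert_subset lessThan_iff order_trans image_insert[THEN equalityD1])
  then show "fst (fst (d (ss ! r)), (stay ss)[r := snd (d (ss ! r))]) < length (program M) \<and>
      length (snd (fst (d (ss ! r)), (stay ss)[r := snd (d (ss ! r))])) = num_tapes M \<and>
      fst ` set (snd (fst (d (ss ! r)), (stay ss)[r := snd (d (ss ! r))])) \<subseteq> {..<num_symbols M}"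
    using d(1) ss by simp
qed

text \<open>The length bound is strict because code may jump to the address just after its end; in
  the complete machine the final \<open>Halt\<close> stands there.\<close>

lemma well_formed_compile:
  assumes "num_tapes M = F + num_tapes N" "num_symbols M = num_symbols N"
    and "registers c \<subseteq> {..F}" and "b + length (compile N F c b) < length (program M)"
    and "i \<in> set (compile N F c b)"
  shows "well_formed_instr M i"
  using assms(3-)
proof (induction c arbitrary: b i)
  case Call
  have goto: "well_formed_instr M (goto (b + length (program N)))"
    using Call.prems assms(1,2) N_bounds F by (auto simp: goto_def intro!: well_formed_tape_step)
  from Call.prems obtain j where j: "j \<in> set (program N)" "i = lift_instr F b (b + length (program N)) j"
    by auto
  then have "well_formed_instr N j"
    using N by (auto simp: turing_machine_def oracle_turing_machine_def)
  show ?case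
  proof (cases j)
    case (Step \<delta>)
    have "b + fst (\<delta> (drop F ss)) < length (program M) \<and>
        length (stay (take F ss) @ snd (\<delta> (drop F ss))) = num_tapes M \<and>
        fst ` set (stay (take F ss) @ snd (\<delta> (drop F ss))) \<subseteq> {..<num_symbols M}"
      if ss: "length ss = num_tapes M" "set ss \<subseteq> {..<num_symbols M}" for ss
    proof -
      have "length (drop F ss) = num_tapes N" "set (drop F ss) \<subseteq> {..<num_symbols N}"
        using ss assms(1,2) set_drop_subset[of F ss] by auto
      then have "fst (\<delta> (drop F ss)) < length (program N)" "length (snd (\<delta> (drop F ss))) = num_tapes N"
        "fst ` set (snd (\<delta> (drop F ss))) \<subseteq> {..<num_symbols N}"
        using \<open>well_formed_instr N j\<close> Step by (auto simp: well_formed_instr_def)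
      then show ?thesis
        using ss assms(1,2) Call.prems set_take_subset[of F ss] by (auto simp: stay_def)
    qed
    then show ?thesis
      using j Step by (simp add: well_formed_instr_def lift_instr_def)
  qed (use goto j in \<open>simp_all add: lift_instr_def\<close>)
next
  case Ask
  then show ?case by (simp add: well_formed_instr_def)
next
  case (Seq c d)
  from Seq.prems consider "i \<in> set (compile N F c b)"
    | "i \<in> set (compile N F d (b + length (compile N F c b)))"
    by (auto simp: Let_def)
  then show ?case
  proof cases
    case 1
    then show ?thesis using Seq.prems by (intro Seq.IH(1)[of b]) (auto simp: Let_def)
  next
    case 2
    then show ?thesis using Seq.prems
      by (intro Seq.IH(2)[of "b + length (compile N F c b)"]) (auto simp: Let_def)
  qed
next
  case (Cond r c d)
  let ?p = "compile N F c (b + 1)"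
  let ?e = "b + length ?p + 2"
  from Cond.prems consider "i = test r (b + 1) ?e" | "i \<in> set ?p"
    | "i = goto (?e + length (compile N F d ?e))" | "i \<in> set (compile N F d ?e)"
    by (auto simp: Let_def)
  then show ?case
  proof cases
    case 1
    then show ?thesis using Cond.prems assms(1,2) N_bounds F
      by (auto simp: Let_def test_def intro!: well_formed_tape_step)
  next
    case 2
    then show ?thesis using Cond.prems by (intro Cond.IH(1)[of "b + 1"]) (auto simp: Let_def)
  next
    case 3
    then show ?thesis using Cond.prems assms(1,2) N_bounds F
      by (auto simp: Let_def goto_def intro!: well_formed_tape_step)
  next
    case 4
    then show ?thesis using Cond.prems by (intro Cond.IH(2)[of ?e]) (auto simp: Let_def)
  qed
next
  case (While r c)
  let ?p = "compile N F c (b + 1)"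
  from While.prems consider "i = test r (b + 1) (b + length ?p + 2)" | "i \<in> set ?p" | "i = goto b"
    by (auto simp: Let_def)
  then show ?case
  proof cases
    case 1
    then show ?thesis using While.prems assms(1,2) N_bounds F
      by (auto simp: Let_def test_def intro!: well_formed_tape_step)
  next
    case 2
    then show ?thesis using While.prems by (intro While.IH[of "b + 1"]) (auto simp: Let_def)
  next
    case 3
    then show ?thesis using While.prems assms(1,2) N_bounds F
      by (auto simp: Let_def goto_def intro!: well_formed_tape_step)
  qed
qed (use assms(1,2) N_bounds F in \<open>auto intro!: well_formed_tape_step\<close>)

lemma oracle_turing_machine_machine_of:
  assumes "registers c \<subseteq> {..F}"
  shows "oracle_turing_machine (machine_of N F c)"
proof -
  have "well_formed_instr (machine_of N F c) i" if "i \<in> set (compile N F c 0)" for i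
    using assms that by (intro well_formed_compile[of _ c 0]) (simp_all add: machine_of_def)
  then show ?thesis
    using N_bounds
    by (auto simp: oracle_turing_machine_def machine_of_def well_formed_instr_def[of _ Halt])
qed

end


section \<open>Weakest preconditions\<close>

definition clear :: "nat \<Rightarrow> com" where
  "clear r = While r (Dec r)"

definition move :: "nat \<Rightarrow> nat \<Rightarrow> com" where
  "move a b = While a (Dec a ;; Inc b)"

text \<open>Reading a register empties it, so its value goes to both \<open>b\<close> and the
  scratch register \<open>c\<close>, from which \<open>a\<close> is restored.\<close>

definition copy :: "nat \<Rightarrow> nat \<Rightarrow> nat \<Rightarrow> com" where
  "copy a b c = While a (Dec a ;; Inc b ;; Inc c) ;; move c a"

text \<open>The loop cancels \<open>a\<close> against \<open>b\<close> and sends the excess of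
  \<open>a\<close> to \<open>d\<close>; the final move sends the excess of \<open>b\<close>.\<close>

definition add_gap :: "nat \<Rightarrow> nat \<Rightarrow> nat \<Rightarrow> com" where
  "add_gap a b d = While a (Dec a ;; Cond b (Dec b) (Inc d)) ;; move b d"

text \<open>
  Counts \<open>v\<close> down to 0 while the pair in registers \<open>m\<close> and \<open>n\<close> runs through the Cantor enumeration.
\<close>

definition decode :: "nat \<Rightarrow> nat \<Rightarrow> nat \<Rightarrow> com" where
  "decode v m n = While v (Dec v ;; Cond n (Dec n ;; Inc m) (move m n ;; Inc n))"

text \<open>The distance |m - n|: at most one of the truncated differences is nonzero.\<close>

definition gap :: "nat \<Rightarrow> nat \<Rightarrow> nat" where
  "gap m n = (m - n) + (n - m)"

lemma gap_eq_0 [simp]: "gap m n = 0 \<longleftrightarrow> m = n"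
  by (auto simp: gap_def)

text \<open>Equality of pairs as the vanishing of a number: several such conditions can be added up
  in one register and tested together.\<close>

definition pair_gap :: "nat \<Rightarrow> nat \<Rightarrow> nat \<Rightarrow> nat" where
  "pair_gap v m n = gap (fst (prod_decode v)) m + gap (snd (prod_decode v)) n"

lemma pair_gap_eq_0: "pair_gap v m n = 0 \<longleftrightarrow> v = prod_encode (m, n)"
  by (metis add_is_0 fst_conv gap_eq_0 pair_gap_def prod.collapse prod_decode_inverse prod_encode_inverse snd_conv)

text \<open>A step along an antidiagonal; the next lemma is the jump to the following antidiagonal.
  They justify the two branches of \<open>decode\<close>.\<close>

lemma prod_encode_Suc_right: "Suc (prod_encode (m, Suc n)) = prod_encode (Suc m, n)"
  by (simp add: prod_encode_def)

lemma prod_encode_0_Suc: "prod_encode (0, Suc m) = Suc (prod_encode (m, 0))"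
  by (simp add: prod_encode_def)

section \<open>Total correctness of the register programs\<close>

context
  fixes \<phi> f :: "nat \<Rightarrow> nat"
begin

text \<open>Execution is deterministic, so the existential form expresses total correctness and
  permits equivalences as rules. Register 13 is the subroutine register.\<close>

definition wp :: "com \<Rightarrow> ((nat \<Rightarrow> nat) \<Rightarrow> bool) \<Rightarrow> (nat \<Rightarrow> nat) \<Rightarrow> bool" where
  "wp c Q s \<longleftrightarrow> (\<exists>s'. exec \<phi> f 13 c s s' \<and> Q s')"

lemma wp_Inc [simp]: "wp (Inc r) Q s \<longleftrightarrow> Q (s(r := Suc (s r)))"
  by (auto simp: wp_def intro: exec.intros elim: exec_IncE)

lemma wp_Dec [simp]: "wp (Dec r) Q s \<longleftrightarrow> Q (s(r := s r - 1))"
  by (auto simp: wp_def intro: exec.intros elim: exec_DecE)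

lemma wp_Ask [simp]: "wp Ask Q s \<longleftrightarrow> Q (s(1 := \<phi> (s 1)))"
  by (auto simp: wp_def intro: exec.intros elim: exec_AskE)

lemma wp_Call [simp]: "wp Call Q s \<longleftrightarrow> Q (s(13 := f (s 13)))"
  by (auto simp: wp_def intro: exec.intros elim: exec_CallE)

lemma wp_Seq [simp]: "wp (c ;; d) Q s \<longleftrightarrow> wp c (wp d Q) s"
  by (auto simp: wp_def[abs_def] intro: exec.intros elim!: exec_SeqE)

lemma wp_Cond [simp]: "wp (Cond r c d) Q s \<longleftrightarrow> (if s r = 0 then wp d Q s else wp c Q s)"
  by (auto simp: wp_def intro: exec.intros elim!: exec_CondE)

lemma wp_While: "wp (While r c) Q s \<longleftrightarrow> (if s r = 0 then Q s else wp c (wp (While r c) Q) s)"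
proof -
  have "exec \<phi> f 13 (While r c) s s' \<longleftrightarrow>
      (if s r = 0 then s' = s else \<exists>t. exec \<phi> f 13 c s t \<and> exec \<phi> f 13 (While r c) t s')" for s'
    by (rule iffI, erule exec_WhileE) (auto split: if_splits intro: exec.intros)
  then show ?thesis by (auto simp: wp_def[abs_def])
qed

lemma wp_clear [simp]: "wp (clear r) Q s \<longleftrightarrow> Q (s(r := 0))"
  unfolding clear_def
proof (induction "s r" arbitrary: s)
  case 0
  then show ?case by (subst wp_While) (simp add: fun_upd_idem)
next
  case (Suc n)
  then show ?case by (subst wp_While) simp
qed

lemma wp_move [simp]:
  assumes "a \<noteq> b"
  shows "wp (move a b) Q s \<longleftrightarrow> Q (s(a := 0, b := s b + s a))"
  unfolding move_def
proof (induction "s a" arbitrary: s)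
  case 0
  then show ?case by (subst wp_While) (simp add: fun_upd_idem)
next
  case (Suc n)
  have "s b + s a = Suc (s b) + n" using Suc.hyps by simp
  then show ?case using Suc assms by (subst wp_While) (simp add: fun_upd_twist)
qed

lemma wp_copy [simp]:
  assumes "a \<noteq> b" "a \<noteq> c" "b \<noteq> c" "s c = 0"
  shows "wp (copy a b c) Q s \<longleftrightarrow> Q (s(b := s b + s a))"
proof -
  have *: "wp (While a (Dec a ;; Inc b ;; Inc c)) Q s \<longleftrightarrow> Q (s(a := 0, b := s b + s a, c := s c + s a))" for Q s
  proof (induction "s a" arbitrary: s)
    case 0
    then show ?case by (subst wp_While) (simp add: fun_upd_idem)
  next
    case (Suc n)
    have "s b + s a = Suc (s b) + n" "s c + s a = Suc (s c) + n" using Suc.hyps by simp_all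
    then show ?case using Suc assms by (subst wp_While) (simp add: fun_upd_twist)
  qed
  have "s(a := 0, b := s b + s a, c := 0, a := s a) = s(b := s b + s a)"
    using assms by (auto simp: fun_eq_iff)
  then show ?thesis
    using assms by (simp add: copy_def *)
qed

lemma wp_add_gap [simp]:
  assumes "a \<noteq> b" "a \<noteq> d" "b \<noteq> d"
  shows "wp (add_gap a b d) Q s \<longleftrightarrow> Q (s(a := 0, b := 0, d := s d + gap (s a) (s b)))"
proof -
  have *: "wp (While a (Dec a ;; Cond b (Dec b) (Inc d))) Q s \<longleftrightarrow>
      Q (s(a := 0, b := s b - s a, d := s d + (s a - s b)))" for Q s
  proof (induction "s a" arbitrary: s)
    case 0
    then show ?case by (subst wp_While) (simp add: fun_upd_idem)
  next
    case (Suc n)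
    have [simp]: "s a = Suc n" using Suc.hyps by simp
    show ?case
    proof (cases "s b")
      case 0
      have "s(a := n, d := Suc (s d), a := 0, b := 0, d := Suc (s d) + n) = s(a := 0, b := 0, d := s d + Suc n)"
        using assms by (auto simp: fun_eq_iff)
      then show ?thesis using 0 Suc.hyps(1)[of "s(a := n, d := Suc (s d))"] assms
        by (subst wp_While) simp
    next
      case (Suc m)
      have "s(a := n, b := m, a := 0, b := m - n, d := s d + (n - m)) = s(a := 0, b := m - n, d := s d + (n - m))"
        using assms by (auto simp: fun_eq_iff)
      then show ?thesis using Suc Suc.hyps(1)[of "s(a := n, b := m)"] assms
        by (subst wp_While) simp
    qed
  qed
  have "s(a := 0, b := s b - s a, d := s d + (s a - s b), b := 0, d := s d + (s a - s b) + (s b - s a)) =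
      s(a := 0, b := 0, d := s d + gap (s a) (s b))"
    using assms by (auto simp: fun_eq_iff gap_def)
  then show ?thesis
    using assms by (simp add: add_gap_def *)
qed

text \<open>The loop invariant is the sum of the code of the current pair and the counter
  \<open>v\<close>; once \<open>v\<close> is 0, the pair has the prescribed code.\<close>

lemma wp_decode_from:
  assumes "v \<noteq> m" "v \<noteq> n" "m \<noteq> n" and "prod_encode (s m, s n) + s v = prod_encode (k, l)"
  shows "wp (decode v m n) Q s \<longleftrightarrow> Q (s(v := 0, m := k, n := l))"
  using assms(4)
proof (induction "s v" arbitrary: s)
  case 0
  then have "s m = k" "s n = l" by (simp_all add: prod_encode_eq)
  with 0 have "s = s(v := 0, m := k, n := l)" by auto
  with 0 show ?case unfolding decode_def by (subst wp_While) simp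
next
  case (Suc w)
  have [simp]: "s v = Suc w" using Suc.hyps by simp
  show ?case
  proof (cases "s n")
    case 0
    have "wp (decode v m n) Q (s(v := w, m := 0, n := Suc (s m))) \<longleftrightarrow>
        Q (s(v := w, m := 0, n := Suc (s m), v := 0, m := k, n := l))"
      using assms(1-3) 0 Suc.prems by (intro Suc.hyps) (simp_all add: prod_encode_0_Suc)
    moreover have "s(v := w, m := 0, n := Suc (s m), v := 0, m := k, n := l) = s(v := 0, m := k, n := l)"
      using assms(1-3) by (auto simp: fun_eq_iff)
    ultimately show ?thesis
      using assms(1-3) 0 unfolding decode_def by (subst wp_While) simp
  next
    case (Suc n')
    have "wp (decode v m n) Q (s(v := w, n := n', m := Suc (s m))) \<longleftrightarrow>
        Q (s(v := w, n := n', m := Suc (s m), v := 0, m := k, n := l))"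
      using assms(1-3) Suc Suc.prems by (intro Suc.hyps) (simp_all flip: prod_encode_Suc_right)
    moreover have "s(v := w, n := n', m := Suc (s m), v := 0, m := k, n := l) = s(v := 0, m := k, n := l)"
      using assms(1-3) by (auto simp: fun_eq_iff)
    ultimately show ?thesis
      using assms(1-3) Suc unfolding decode_def by (subst wp_While) simp
  qed
qed

lemma wp_decode [simp]:
  assumes "v \<noteq> m" "v \<noteq> n" "m \<noteq> n" "s m = 0" "s n = 0"
  shows "wp (decode v m n) Q s \<longleftrightarrow>
    Q (s(v := 0, m := fst (prod_decode (s v)), n := snd (prod_decode (s v))))"
proof (rule wp_decode_from)
  have "prod_encode (0, 0) = 0" by (simp add: prod_encode_def)
  then show "prod_encode (s m, s n) + s v = prod_encode (fst (prod_decode (s v)), snd (prod_decode (s v)))"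
    using assms(4,5) by simp
qed (use assms in auto)


section \<open>The nesting program\<close>

text \<open>
  Registers: 0 input and output, 1 oracle and current candidate, 2 last value \<open>b\<close> of the nested
  oracle, 3 its index \<open>j\<close>, 4 search position \<open>t\<close>, 5 the defect of the candidate, 6 to 12
  scratch, 13 the subroutine.
\<close>

definition match :: "nat \<Rightarrow> nat \<Rightarrow> com" where
  "match i e = move i 13 ;; Call ;; decode 13 8 9 ;;
     copy 1 6 7 ;; add_gap 8 6 5 ;; copy e 6 7 ;; add_gap 9 6 5"

text \<open>Registers 8, 10 and 11 receive \<open>k\<close>, \<open>i\<^sub>1\<close> and
  \<open>i\<^sub>2\<close>. The first query fetches \<phi> at \<open>j\<close>, kept in register 12;
  the second leaves the candidate \<phi> at \<open>k\<close> in register 1.\<close>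

definition try_candidate :: com where
  "try_candidate = clear 5 ;; clear 1 ;; copy 4 6 7 ;; decode 6 8 9 ;; decode 9 10 11 ;;
     copy 3 1 7 ;; Ask ;; move 1 12 ;; move 8 1 ;; Ask ;; match 10 2 ;; match 11 12 ;; clear 12 ;; Inc 4"

text \<open>The loop tests the defect of the previous candidate; \<open>Inc 5\<close> is a dummy
  defect that forces the first round.\<close>

definition extend :: com where
  "extend = clear 4 ;; Inc 5 ;; While 5 try_candidate ;; clear 2 ;; move 1 2"

text \<open>Register 1 starts at 0, so the first query returns \<open>\<phi> 0\<close>. The last
  commands restore the standard configuration.\<close>

definition nest :: com where
  "nest = Ask ;; move 1 2 ;; While 0 (Dec 0 ;; Inc 3 ;; extend) ;; move 2 0 ;; clear 3 ;; clear 4"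

lemma registers_nest: "registers nest \<subseteq> {..13}"
  by (simp add: nest_def extend_def try_candidate_def match_def clear_def move_def copy_def
      decode_def add_gap_def)

text \<open>Between candidates the scratch registers and the subroutine register are empty, so six
  values describe the store.\<close>

definition state :: "nat \<Rightarrow> nat \<Rightarrow> nat \<Rightarrow> nat \<Rightarrow> nat \<Rightarrow> nat \<Rightarrow> nat \<Rightarrow> nat" where
  "state n c b j t d = (\<lambda>_. 0)(0 := n, 1 := c, 2 := b, 3 := j, 4 := t, 5 := d)"

text \<open>
  A search position codes a triple \<open>(k, i\<^sub>1, i\<^sub>2)\<close>; its defect vanishes iff \<open>f\<close> enumerates the pair
  \<open>(\<phi> k, b)\<close> at \<open>i\<^sub>1\<close> and the pair \<open>(\<phi> k, e)\<close> at \<open>i\<^sub>2\<close>.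
\<close>

definition candidate :: "nat \<Rightarrow> nat" where
  "candidate t = \<phi> (fst (prod_decode t))"

definition defect :: "nat \<Rightarrow> nat \<Rightarrow> nat \<Rightarrow> nat" where
  "defect b e t = (let u = prod_decode (snd (prod_decode t)) in
     pair_gap (f (fst u)) (candidate t) b + pair_gap (f (snd u)) (candidate t) e)"

text \<open>The search goes upwards from 0, so it stops at the least position without defect,
  provided there is one.\<close>

definition refine :: "nat \<Rightarrow> nat \<Rightarrow> nat" where
  "refine b e = candidate (LEAST t. defect b e t = 0)"

primrec nesting :: "nat \<Rightarrow> nat" where
  "nesting 0 = \<phi> 0"
| "nesting (Suc n) = refine (nesting n) (\<phi> (Suc n))"

text \<open>All candidates are values of \<phi>, so the new oracle inherits valid codes of
  neighbourhoods of the point.\<close>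

lemma nesting_in_range: "nesting n \<in> range \<phi>"
  by (cases n) (simp_all add: refine_def candidate_def)

section \<open>Correctness of the nesting program\<close>

lemma wp_match:
  assumes "i \<notin> {1, 5, 6, 7, 8, 9, 13, e}" "e \<notin> {1, 5, 6, 7, 8, 9, 13}"
    and "s 6 = 0" "s 7 = 0" "s 8 = 0" "s 9 = 0" "s 13 = 0"
  shows "wp (match i e) Q s \<longleftrightarrow> Q (s(i := 0, 5 := s 5 + pair_gap (f (s i)) (s 1) (s e)))"
proof -
  let ?u = "prod_decode (f (s i))"
  have neq: "Suc 0 \<noteq> i" "e \<noteq> i"
    using assms(1) by auto
  have "wp (match i e) Q s \<longleftrightarrow> Q (s(i := 0, 13 := 0, 8 := 0, 9 := 0, 6 := 0,
      5 := s 5 + gap (fst ?u) (s 1) + gap (snd ?u) (s e)))"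
    using assms neq unfolding match_def by (simp add: fun_upd_twist)
  moreover have "s(i := 0, 13 := 0, 8 := 0, 9 := 0, 6 := 0,
        5 := s 5 + gap (fst ?u) (s 1) + gap (snd ?u) (s e)) =
      s(i := 0, 5 := s 5 + pair_gap (f (s i)) (s 1) (s e))"
    using assms by (auto simp: fun_eq_iff pair_gap_def)
  ultimately show ?thesis by simp
qed

text \<open>The old \<open>c\<close> and \<open>d\<close> are overwritten, and the position advances
  even when the candidate succeeds.\<close>

lemma wp_try_candidate:
  "wp try_candidate Q (state n c b j t d) \<longleftrightarrow> Q (state n (candidate t) b j (Suc t) (defect b (\<phi> j) t))"
  unfolding try_candidate_def state_def
  by (simp add: wp_match)
    (rule arg_cong[where f = Q], auto simp: fun_eq_iff defect_def candidate_def Let_def)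

lemma state_5: "state n c b j t d 5 = d"
  by (simp add: state_def)

text \<open>Induction on the distance from \<open>t\<close> to the least zero of the defect: earlier
  positions leave a nonzero defect and keep the loop running. The final position is one past that
  zero.\<close>

lemma wp_search:
  assumes "defect b (\<phi> j) t' = 0" "t \<le> (LEAST t. defect b (\<phi> j) t = 0)" "d \<noteq> 0"
  shows "wp (While 5 try_candidate) Q (state n c b j t d) \<longleftrightarrow>
    Q (state n (refine b (\<phi> j)) b j (Suc (LEAST t. defect b (\<phi> j) t = 0)) 0)"
  using assms(2,3)
proof (induction "(LEAST t. defect b (\<phi> j) t = 0) - t" arbitrary: t c d)
  case 0
  then have t: "t = (LEAST t. defect b (\<phi> j) t = 0)" by simp
  have "defect b (\<phi> j) t = 0" unfolding t using assms(1) by (rule LeastI)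
  then show ?case
    using 0 t
    by (subst wp_While, simp add: wp_try_candidate state_5)
      (subst wp_While, simp add: state_5 refine_def)
next
  case (Suc m)
  then have "t < (LEAST t. defect b (\<phi> j) t = 0)" by simp
  then have "defect b (\<phi> j) t \<noteq> 0" by (rule not_less_Least)
  then show ?case
    using Suc.prems Suc.hyps(2) Suc.hyps(1)[of "Suc t" "defect b (\<phi> j) t" "candidate t"]
    by (subst wp_While) (simp add: wp_try_candidate state_5)
qed

text \<open>The leftover position \<open>t'\<close> may stay unspecified, since the next
  \<open>extend\<close> clears register 4. It precedes the quantifier over \<open>Q\<close> so that
  one final store serves all postconditions.\<close>

lemma wp_extend:
  assumes "\<exists>t. defect b (\<phi> j) t = 0"
  shows "\<exists>t'. \<forall>Q. wp extend Q (state n 0 b j t 0) \<longleftrightarrow> Q (state n 0 (refine b (\<phi> j)) j t' 0)"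
proof -
  let ?t = "LEAST t. defect b (\<phi> j) t = 0"
  have start: "(state n 0 b j t 0)(4 := 0, 5 := 1) = state n 0 b j 0 1"
    by (auto simp: state_def fun_eq_iff)
  have finish: "(state n c b j t' 0)(2 := 0, 1 := 0, 2 := c) = state n 0 c j t' 0" for c t'
    by (auto simp: state_def fun_eq_iff)
  have candidate: "state n c b j t' 0 1 = c" for c t'
    by (simp add: state_def)
  have "wp extend Q (state n 0 b j t 0) \<longleftrightarrow> Q (state n 0 (refine b (\<phi> j)) j (Suc ?t) 0)" for Q
    using assms start finish candidate
    by (auto simp: extend_def wp_search state_5)
  then show ?thesis by blast
qed

lemma wp_nest:
  assumes "\<And>n. \<exists>t. defect (nesting n) (\<phi> (Suc n)) t = 0"
  shows "wp nest (\<lambda>s. s = (\<lambda>_. 0)(0 := nesting n)) ((\<lambda>_. 0)(0 := n))"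
proof -
  let ?loop = "While 0 (Dec 0 ;; Inc 3 ;; extend)"
  \<comment> \<open>Invariant: register 3 holds the index reached so far and register 2 the nested
    value there; register 0 counts the remaining rounds.\<close>
  have loop: "\<exists>t'. \<forall>Q. wp ?loop Q (state n 0 (nesting m) m t 0) \<longleftrightarrow>
      Q (state 0 0 (nesting (n + m)) (n + m) t' 0)" for n m t
  proof (induction n arbitrary: m t)
    case 0
    show ?case by (subst wp_While) (auto simp: state_def)
  next
    case (Suc n)
    obtain t1 where t1: "\<And>Q. wp extend Q (state n 0 (nesting m) (Suc m) t 0) \<longleftrightarrow>
        Q (state n 0 (nesting (Suc m)) (Suc m) t1 0)"
      using wp_extend[OF assms] by fastforce
    obtain t2 where t2: "\<And>Q. wp ?loop Q (state n 0 (nesting (Suc m)) (Suc m) t1 0) \<longleftrightarrow>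
        Q (state 0 0 (nesting (n + Suc m)) (n + Suc m) t2 0)"
      using Suc.IH by blast
    have upd: "(state (Suc n) 0 (nesting m) m t 0)(0 := n, 3 := Suc m) = state n 0 (nesting m) (Suc m) t 0"
      by (auto simp: state_def fun_eq_iff)
    have vals: "state (Suc n) 0 (nesting m) m t 0 0 = Suc n" "state (Suc n) 0 (nesting m) m t 0 3 = m"
      by (simp_all add: state_def)
    have "wp ?loop Q (state (Suc n) 0 (nesting m) m t 0) \<longleftrightarrow>
        Q (state 0 0 (nesting (Suc n + m)) (Suc n + m) t2 0)" for Q
      using upd t1 t2 by (subst wp_While) (simp add: vals)
    then show ?case by blast
  qed
  obtain t where t: "\<And>Q. wp ?loop Q (state n 0 (nesting 0) 0 0 0) \<longleftrightarrow>
      Q (state 0 0 (nesting n) n t 0)"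
    using loop[of n 0 0] by auto
  have "((\<lambda>_. 0)(0 := n))(1 := 0, 2 := \<phi> 0) = state n 0 (nesting 0) 0 0 0"
    by (auto simp: state_def fun_eq_iff)
  moreover have "(state 0 0 (nesting n) n t 0)(2 := 0, 0 := nesting n, 3 := 0, 4 := 0) = (\<lambda>_. 0)(0 := nesting n)"
    by (auto simp: state_def fun_eq_iff)
  moreover have "state 0 0 (nesting n) n t 0 2 = nesting n" "state 0 0 (nesting n) n t 0 0 = 0"
    by (simp_all add: state_def)
  ultimately show ?thesis
    using t by (simp add: nest_def)
qed

end

lemma computes_nest:
  assumes "turing_machine N" "computes N (\<lambda>_. 0) f"
    and "\<And>n. \<exists>t. defect \<phi> f (nesting \<phi> f n) (\<phi> (Suc n)) t = 0"
  shows "computes (machine_of N 13 nest) \<phi> (nesting \<phi> f)"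
proof -
  interpret subroutine N f 13
    using assms by unfold_locales auto
  show ?thesis
  proof (rule computes_machine_of[OF _ registers_nest])
    show "exec \<phi> f 13 nest ((\<lambda>_. 0)(0 := n)) ((\<lambda>_. 0)(0 := nesting \<phi> f n))" for n
      using wp_nest[OF assms(3), of n] by (auto simp: wp_def)
  qed
qed

lemma defect_eq_0:
  "defect \<phi> f b e t = 0 \<longleftrightarrow> (\<exists>i j. snd (prod_decode t) = prod_encode (i, j) \<and>
     f i = prod_encode (candidate \<phi> t, b) \<and> f j = prod_encode (candidate \<phi> t, e))"
proof -
  obtain i j where "snd (prod_decode t) = prod_encode (i, j)"
    by (metis prod.collapse prod_decode_inverse)
  then show ?thesis
    by (auto simp: defect_def Let_def pair_gap_eq_0 prod_encode_eq)
qed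


section \<open>Nested oracles\<close>

lemma subset_relation_iff:
  "prod_encode (b, c) \<in> subset_relation \<B> \<nu> \<longleftrightarrow>
     b \<in> code_dom \<B> \<nu> \<and> c \<in> code_dom \<B> \<nu> \<and> the (\<nu> b) \<subseteq> the (\<nu> c)"
  by (auto simp: subset_relation_def prod_encode_eq)

lemma oracle_for_iff:
  "oracle_for \<B> \<nu> x \<phi> \<longleftrightarrow>
     (\<forall>n. \<phi> n \<in> code_dom \<B> \<nu> \<and> the (\<nu> (\<phi> n)) \<in> \<B> \<and> x \<in> the (\<nu> (\<phi> n))) \<and>
     (\<forall>B \<in> \<B>. x \<in> B \<longrightarrow> (\<exists>n. the (\<nu> (\<phi> n)) \<subseteq> B))"
proof -
  have "{the (\<nu> (\<phi> n)) | n. True} = range (\<lambda>n. the (\<nu> (\<phi> n)))" by auto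
  then show ?thesis
    by (simp add: oracle_for_def local_basis_def image_subset_iff all_conj_distrib)
qed

text \<open>The intersection is an open neighbourhood of \<open>x\<close>, hence contains a basis
  element around \<open>x\<close>, and the oracle reaches below that element.\<close>

lemma common_refinement:
  assumes "basis_of T \<B>" "oracle_for \<B> \<nu> x \<phi>"
  shows "\<exists>k. the (\<nu> (\<phi> k)) \<subseteq> the (\<nu> (\<phi> m)) \<inter> the (\<nu> (\<phi> n))"
proof -
  let ?U = "the (\<nu> (\<phi> m)) \<inter> the (\<nu> (\<phi> n))"
  have "openin T ?U"
    using assms by (intro openin_Int) (auto simp: basis_of_def oracle_for_iff)
  moreover have "x \<in> ?U"
    using assms(2) by (simp add: oracle_for_iff)
  ultimately obtain V where V: "V \<in> \<B>" "x \<in> V" "V \<subseteq> ?U"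
    using assms(1) unfolding basis_of_def by metis
  then obtain k where "the (\<nu> (\<phi> k)) \<subseteq> V"
    using assms(2) by (auto simp: oracle_for_iff)
  with V(3) show ?thesis by blast
qed

lemma ex_defect_eq_0:
  assumes "basis_of T \<B>" "oracle_for \<B> \<nu> x \<phi>" "subset_relation \<B> \<nu> = range f"
  shows "\<exists>t. defect \<phi> f (\<phi> m) (\<phi> n) t = 0"
proof -
  obtain k where k: "the (\<nu> (\<phi> k)) \<subseteq> the (\<nu> (\<phi> m)) \<inter> the (\<nu> (\<phi> n))"
    using common_refinement[OF assms(1,2)] by blast
  have "\<phi> i \<in> code_dom \<B> \<nu>" for i
    using assms(2) by (simp add: oracle_for_iff)
  with k have "prod_encode (\<phi> k, \<phi> m) \<in> range f" "prod_encode (\<phi> k, \<phi> n) \<in> range f"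
    by (auto simp: subset_relation_iff simp flip: assms(3))
  then obtain i j where "f i = prod_encode (\<phi> k, \<phi> m)" "f j = prod_encode (\<phi> k, \<phi> n)"
    by (metis rangeE)
  \<comment> \<open>The witness codes the index \<open>k\<close> of a common refinement together
    with the positions at which \<open>f\<close> lists the two inclusions.\<close>
  then have "defect \<phi> f (\<phi> m) (\<phi> n) (prod_encode (k, prod_encode (i, j))) = 0"
    by (simp add: defect_eq_0 candidate_def prod_encode_eq)
  then show ?thesis by blast
qed

text \<open>Soundness of the search: a vanishing defect exhibits both pairs in the range of
  \<open>f\<close>, and every listed pair is a true inclusion.\<close>

lemma refine_subset:
  assumes "subset_relation \<B> \<nu> = range f" "\<exists>t. defect \<phi> f b e t = 0"
  shows "the (\<nu> (refine \<phi> f b e)) \<subseteq> the (\<nu> b) \<inter> the (\<nu> e)"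
proof -
  have "defect \<phi> f b e (LEAST t. defect \<phi> f b e t = 0) = 0"
    using assms(2) by (rule LeastI_ex)
  then obtain i j where "prod_encode (refine \<phi> f b e, b) = f i" "prod_encode (refine \<phi> f b e, e) = f j"
    unfolding defect_eq_0 refine_def by metis
  then have "prod_encode (refine \<phi> f b e, b) \<in> range f" "prod_encode (refine \<phi> f b e, e) \<in> range f"
    by simp_all
  then show ?thesis
    by (auto simp: subset_relation_iff simp flip: assms(1))
qed

lemma nesting_oracle:
  assumes "basis_of T \<B>" "oracle_for \<B> \<nu> x \<phi>" "subset_relation \<B> \<nu> = range f"
  shows ex_defect_nesting: "\<exists>t. defect \<phi> f (nesting \<phi> f n) (\<phi> (Suc n)) t = 0"
    and oracle_for_nesting: "oracle_for \<B> \<nu> x (nesting \<phi> f)"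
    and nested_nesting: "nested \<nu> (nesting \<phi> f)"
proof -
  \<comment> \<open>The current nested value is itself some \<open>\<phi> m\<close>, so the search
    between two values of \<phi> applies.\<close>
  have ex: "\<exists>t. defect \<phi> f (nesting \<phi> f n) (\<phi> (Suc n)) t = 0" for n
    using nesting_in_range[of \<phi> f n] ex_defect_eq_0[OF assms] by auto
  then show "\<exists>t. defect \<phi> f (nesting \<phi> f n) (\<phi> (Suc n)) t = 0" .
  have sub: "the (\<nu> (nesting \<phi> f (Suc n))) \<subseteq> the (\<nu> (nesting \<phi> f n)) \<inter> the (\<nu> (\<phi> (Suc n)))" for n
    using refine_subset[OF assms(3) ex] by simp
  then show "nested \<nu> (nesting \<phi> f)"
    by (auto simp: nested_def)
  \<comment> \<open>Staying below \<phi> index by index carries the local basis property over; at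
    index 0 the two oracles agree.\<close>
  have cofinal: "the (\<nu> (nesting \<phi> f n)) \<subseteq> the (\<nu> (\<phi> n))" for n
  proof (cases n)
    case (Suc m)
    then show ?thesis using sub[of m] by blast
  qed simp
  show "oracle_for \<B> \<nu> x (nesting \<phi> f)"
    unfolding oracle_for_iff
  proof (intro conjI allI ballI impI)
    fix n
    obtain m where m: "nesting \<phi> f n = \<phi> m"
      using nesting_in_range[of \<phi> f n] by auto
    show "nesting \<phi> f n \<in> code_dom \<B> \<nu>" "the (\<nu> (nesting \<phi> f n)) \<in> \<B>" "x \<in> the (\<nu> (nesting \<phi> f n))"
      using assms(2) by (simp_all add: m oracle_for_iff)
  next
    fix B
    assume "B \<in> \<B>" "x \<in> B"
    then obtain n where "the (\<nu> (\<phi> n)) \<subseteq> B"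
      using assms(2) by (auto simp: oracle_for_iff)
    then show "\<exists>n. the (\<nu> (nesting \<phi> f n)) \<subseteq> B"
      using cofinal by blast
  qed
qed

text \<open>Uniformity is the order of the quantifiers: the machine is built from an enumeration of
  the subset relation before \<open>x\<close> and \<phi> are given.\<close>

theorem theorem8:
  fixes T :: "'a topology" and \<B> :: "'a set set" and \<nu> :: "nat \<rightharpoonup> 'a set"
  assumes "effective_topology T \<B> \<nu>"
    and "recursively_enumerable (subset_relation \<B> \<nu>)"
  shows "\<exists>M. oracle_turing_machine M \<and>
           (\<forall>x \<in> topspace T. \<forall>\<phi>. oracle_for \<B> \<nu> x \<phi> \<longrightarrow>
              (\<exists>\<psi>. oracle_for \<B> \<nu> x \<psi> \<and> nested \<nu> \<psi> \<and> computes M \<phi> \<psi>))"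
proof (cases "subset_relation \<B> \<nu> = {}")
  case True
  \<comment> \<open>By reflexivity of inclusion, any oracle would put the pair of
    \<open>\<phi> 0\<close> with itself into the relation. So there are no oracles, and any machine
    will do.\<close>
  have "\<not> oracle_for \<B> \<nu> x \<phi>" for x \<phi>
    using True subset_relation_iff[of "\<phi> 0" "\<phi> 0" \<B> \<nu>] by (auto simp: oracle_for_iff)
  moreover have "oracle_turing_machine \<lparr>num_tapes = 2, num_symbols = 2, program = [Halt]\<rparr>"
    by (simp add: oracle_turing_machine_def well_formed_instr_def)
  ultimately show ?thesis by blast
next
  case False
  then obtain N f where machine: "turing_machine N" "computes N (\<lambda>_. 0) f"
    and range: "subset_relation \<B> \<nu> = range f"
    using assms(2) by (auto simp: recursively_enumerable_def recursive_def)
  interpret subroutine N f 13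
    using machine by unfold_locales auto
  have "oracle_for \<B> \<nu> x (nesting \<phi> f) \<and> nested \<nu> (nesting \<phi> f) \<and>
      computes (machine_of N 13 nest) \<phi> (nesting \<phi> f)" if "oracle_for \<B> \<nu> x \<phi>" for x \<phi>
  proof -
    have basis: "basis_of T \<B>"
      using assms(1) by (simp add: effective_topology_def)
    show ?thesis
      using nesting_oracle[OF basis that range] computes_nest[OF machine] by blast
  qed
  then show ?thesis
    using oracle_turing_machine_machine_of[OF registers_nest] by blast
qed

end
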